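(* Let $m\ge 1$ be an integer and suppose $\zeta_{1},\zeta_{2}\ne 0$ are complex numbers such that $\frac{1}{\zeta_{1}}+\frac{1}{\zeta_{2}}+1=0$ and $$\frac{\zeta_{1}^{m+1}-1}{\zeta_{1}-1}=\frac{\zeta_{2}^{m+1}-1}{\zeta_{2}-1}.$$ Then $\zeta_{1}$ and $\zeta_{2}$ lie on the union $C_{1}\cup C_{2}\cup C_{3}$, where, writing points of $\mathbb{C}$ as $x+iy$ with $x,y\in\mathbb{R}$, $$C_{1}: (x+1)^{2}+y^{2}=1,\ x\le-\tfrac{1}{2};\qquad C_{2}: x=-\tfrac{1}{2},\ -\tfrac{\sqrt{3}}{2}\le y\le\tfrac{\sqrt{3}}{2};\qquad C_{3}: x^{2}+y^{2}=1,\ x\ge-\tfrac{1}{2}.$$ Moreover, such numbers are dense in $C_1\cup C_2\cup C_3$ as $m\to\infty$: for every $p\in C_1\cup C_2\cup C_3$ and every open neighborhood $U$ of $p$ in $\mathbb{C}$, for all sufficiently large $m$ there is a pair $(\zeta_1,\zeta_2)$ of nonzero complex numbers with $\frac{1}{\zeta_{1}}+\frac{1}{\zeta_{2}}+1=0$, $\frac{\zeta_{1}^{m+1}-1}{\zeta_{1}-1}=\frac{\zeta_{2}^{m+1}-1}{\zeta_{2}-1}$ and $\zeta_1\in U$.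
   Context: The quotient $\frac{\zeta^{m+1}-1}{\zeta-1}$ is understood as $\sum_{k=0}^{m}\zeta^{k}$. The conditions on $(\zeta_1,\zeta_2)$ are symmetric in $\zeta_1$ and $\zeta_2$. *)

theory Defs
  imports Complex_Main
begin

text \<open>The quotient \<open>(\<zeta>\<^bsup>m+1\<^esup> - 1) / (\<zeta> - 1)\<close>, read as the polynomial it represents,
  so that \<open>\<zeta> = 1\<close> gives \<open>m + 1\<close> rather than \<open>0 / 0 = 0\<close>.\<close>

definition geom_quotient :: "nat \<Rightarrow> complex \<Rightarrow> complex" where
  "geom_quotient m \<zeta> = (\<Sum>k=0..m. \<zeta> ^ k)"

definition admissible_pair :: "nat \<Rightarrow> complex \<Rightarrow> complex \<Rightarrow> bool" where
  "admissible_pair m \<zeta>\<^sub>1 \<zeta>\<^sub>2 \<longleftrightarrow>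
     \<zeta>\<^sub>1 \<noteq> 0 \<and> \<zeta>\<^sub>2 \<noteq> 0 \<and> 1 / \<zeta>\<^sub>1 + 1 / \<zeta>\<^sub>2 + 1 = 0 \<and>
     geom_quotient m \<zeta>\<^sub>1 = geom_quotient m \<zeta>\<^sub>2"

definition C1 :: "complex set" where
  "C1 = {z. (Re z + 1)\<^sup>2 + (Im z)\<^sup>2 = 1 \<and> Re z \<le> - 1 / 2}"

definition C2 :: "complex set" where
  "C2 = {z. Re z = - 1 / 2 \<and> - sqrt 3 / 2 \<le> Im z \<and> Im z \<le> sqrt 3 / 2}"

definition C3 :: "complex set" where
  "C3 = {z. (Re z)\<^sup>2 + (Im z)\<^sup>2 = 1 \<and> Re z \<ge> - 1 / 2}"

end

theory Submission
  imports Defs "HOL-Computational_Algebra.Polynomial"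
begin

text \<open>
  Write an admissible pair homogeneously as \<open>\<zeta>\<^sub>1 = a / c\<close>, \<open>\<zeta>\<^sub>2 = b / c\<close>. The relation between the
  reciprocals becomes \<open>ab + bc + ca = 0\<close>, and the difference of the two geometric quotients is
  \<open>\<zeta>\<^sub>1 - \<zeta>\<^sub>2\<close> times the complete homogeneous symmetric polynomial of degree \<open>n = m - 1\<close> in
  \<open>\<zeta>\<^sub>1, \<zeta>\<^sub>2, 1\<close> (\<open>geom_quotient_diff\<close>). So the problem is symmetric in the triple \<open>a, b, c\<close>.
  Since the second elementary symmetric polynomial vanishes, this \<open>hsym\<close> depends only on
  \<open>s = a + b + c\<close> and \<open>p = abc\<close>, and up to a power of \<open>s\<close> it is a polynomial of degree at most
  \<open>n div 3\<close> in the single scale-invariant quantity \<open>p / s\<^sup>3\<close> (\<open>degree_hsym\<close>).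

  The three curves are exactly the ratios of two entries of the triples
  \<open>(e\<^bsup>it\<^esup>, e\<^bsup>-it\<^esup>, -1 / (2 cos t))\<close> with \<open>\<bar>t\<bar> \<le> \<pi>/3\<close>: the triples in which the two entries of
  largest modulus have equal modulus, scaled so that this modulus is 1 and the third entry is
  real. For such a triple \<open>s\<close> and \<open>p\<close> are real, and for \<open>0 < t < \<pi>/3\<close> the value of \<open>hsym\<close> is, up to a
  nonvanishing factor, an explicit trigonometric function of \<open>t\<close> (\<open>hsym_trigonometric\<close>). That
  function changes sign between consecutive sample points spaced by \<open>2\<pi> / (2n + 3)\<close>, which gives
  \<open>n div 3\<close> zeros in \<open>(0, \<pi>/3)\<close>. As \<open>p / s\<^sup>3\<close> is strictly monotone in \<open>t\<close>, these are
  \<open>n div 3\<close> different roots of a polynomial of at most that degree, hence all of its roots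
  (\<open>hsym_roots\<close>). Every admissible triple is therefore proportional to one of the special triples,
  the degenerate cases \<open>\<zeta>\<^sub>1 = \<zeta>\<^sub>2\<close> and \<open>s = 0\<close> corresponding to \<open>t = 0\<close> and \<open>\<bar>t\<bar> = \<pi>/3\<close>. This is the
  first claim. The density claim follows because the zeros fill \<open>(0, \<pi>/3)\<close> with gaps that tend
  to 0 as \<open>n\<close> grows, and \<open>t\<close> and \<open>-t\<close> are zeros together.
\<close>

section \<open>Complete homogeneous symmetric polynomials of triples with \<open>ab + bc + ca = 0\<close>\<close>

text \<open>
  The value at \<open>(a, b, c)\<close> of the complete homogeneous symmetric polynomial of degree \<open>n\<close>, when
  \<open>a + b + c = s\<close>, \<open>ab + bc + ca = 0\<close> and \<open>abc = p\<close>: its generating function is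
  \<open>1 / (1 - s x - p x\<^sup>3)\<close>. Taking \<open>s\<close> and \<open>p\<close> in a commutative ring makes the same recursion
  produce complex values, real values, and, for \<open>p = [:0, 1:]\<close>, a polynomial.
\<close>

fun hsym :: "'a::comm_ring_1 \<Rightarrow> 'a \<Rightarrow> nat \<Rightarrow> 'a" where
  "hsym s p 0 = 1"
| "hsym s p (Suc 0) = s"
| "hsym s p (Suc (Suc 0)) = s ^ 2"
| "hsym s p (Suc (Suc (Suc n))) = s * hsym s p (Suc (Suc n)) + p * hsym s p n"

lemma hsym_homogeneous: "hsym (c * s) (c ^ 3 * p) n = c ^ n * hsym s p n"
  by (induction s p n rule: hsym.induct) (simp_all add: algebra_simps power2_eq_square power3_eq_cube)

lemma hsym_of_real:
  "hsym (of_real s) (of_real p) n = (of_real (hsym s p n) :: 'a::{comm_ring_1,real_algebra_1})"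
  by (induction s p n rule: hsym.induct) simp_all

lemma poly_hsym: "poly (hsym 1 [:0, 1:] n) x = hsym 1 x n"
  by (induction "1 :: 'a poly" "[:0, 1:] :: 'a poly" n rule: hsym.induct) simp_all

text \<open>
  In the recursion the factor \<open>p\<close> costs one degree and lowers \<open>n\<close> by three.
\<close>

lemma degree_hsym: "degree (hsym 1 [:0, 1:] n :: 'a::comm_ring_1 poly) \<le> n div 3"
proof (induction "1 :: 'a poly" "[:0, 1:] :: 'a poly" n rule: hsym.induct)
  case (4 n)
  have "degree ([:0, 1:] * hsym 1 [:0, 1:] n :: 'a poly) \<le> 1 + n div 3"
    using degree_mult_le[of "[:0, 1:] :: 'a poly" "hsym 1 [:0, 1:] n"] 4(2)
    by (auto intro: order.trans)
  moreover have "degree (hsym 1 [:0, 1:] (Suc (Suc n)) :: 'a poly) \<le> 1 + n div 3"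
    using 4(1) by linarith
  ultimately show ?case
    by (simp add: degree_add_le)
qed simp_all

lemma hsym_zero_right: "hsym 1 (0 :: 'a::comm_ring_1) n = 1"
  by (induction "1 :: 'a" "0 :: 'a" n rule: hsym.induct) simp_all

section \<open>Admissible pairs as zeros of \<open>hsym\<close>\<close>

lemma geom_quotient_Suc: "geom_quotient (Suc m) z = z * geom_quotient m z + 1"
proof (induction m)
  case (Suc m)
  have step: "geom_quotient (Suc k) z = geom_quotient k z + z ^ Suc k" for k
    by (simp add: geom_quotient_def)
  have "geom_quotient (Suc (Suc m)) z = (z * geom_quotient m z + 1) + z * z ^ Suc m"
    unfolding step[of "Suc m"] Suc by simp
  also have "\<dots> = z * geom_quotient (Suc m) z + 1"
    unfolding step[of m] by (simp add: algebra_simps)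
  finally show ?case .
qed (simp add: geom_quotient_def)

text \<open>
  The numbers \<open>1, z, w\<close> are the roots of \<open>T\<^sup>3 = (z + w + 1) T\<^sup>2 + z w\<close>, and \<open>geom_quotient m z\<close> is a
  combination of \<open>1\<close> and \<open>z\<^bsup>m\<^esup>\<close>; hence it obeys the recurrence of \<open>hsym\<close>, and so does the
  difference of the quotients at \<open>z\<close> and \<open>w\<close>.
\<close>

lemma geom_quotient_recurrence:
  assumes "z * w + z + w = 0"
  shows "geom_quotient (Suc (Suc (Suc m))) z =
           (z + w + 1) * geom_quotient (Suc (Suc m)) z + (z * w) * geom_quotient m z"
  using assms unfolding geom_quotient_Suc by algebra

lemma geom_quotient_diff:
  assumes e: "z * w + z + w = 0"
  shows "geom_quotient (Suc n) z - geom_quotient (Suc n) w = (z - w) * hsym (z + w + 1) (z * w) n"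
proof (induction "z + w + 1" "z * w" n rule: hsym.induct)
  case 1
  show ?case by (simp add: geom_quotient_def)
next
  case 2
  show ?case by (simp add: geom_quotient_def algebra_simps power2_eq_square)
next
  case 3
  show ?case using e unfolding geom_quotient_Suc hsym.simps
    by (simp add: geom_quotient_def) algebra
next
  case (4 n)
  have e': "w * z + w + z = 0" using e by (simp add: algebra_simps)
  show ?case
    using geom_quotient_recurrence[OF e, of "Suc n"] geom_quotient_recurrence[OF e', of "Suc n"] 4
    unfolding hsym.simps by algebra
qed

lemma reciprocal_sum_iff:
  fixes z w :: complex
  assumes "z \<noteq> 0" "w \<noteq> 0"
  shows "1 / z + 1 / w + 1 = 0 \<longleftrightarrow> z * w + z + w = 0"
  using assms by (simp add: field_simps)

text \<open>
  Homogeneity removes the normalisation \<open>c = 1\<close>, so one triple yields pairs for every choice of its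
  denominator.
\<close>

lemma admissible_pair_ratios:
  assumes "a \<noteq> 0" "b \<noteq> 0" "c \<noteq> 0" and e2: "a * b + b * c + c * a = 0"
    and h: "hsym (a + b + c) (a * b * c) n = 0"
  shows "admissible_pair (Suc n) (a / c) (b / c)"
proof -
  have e: "(a / c) * (b / c) + a / c + b / c = 0"
    using e2 assms by (simp add: field_simps)
  have "c * (a / c + b / c + 1) = a + b + c" "c ^ 3 * ((a / c) * (b / c)) = a * b * c"
    using assms by (simp_all add: field_simps power3_eq_cube)
  hence "c ^ n * hsym (a / c + b / c + 1) ((a / c) * (b / c)) n = 0"
    unfolding hsym_homogeneous[symmetric] using h by simp
  hence "hsym (a / c + b / c + 1) ((a / c) * (b / c)) n = 0"
    using assms by simp
  moreover have "1 / (a / c) + 1 / (b / c) + 1 = 0"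
    using e assms by (subst reciprocal_sum_iff) simp_all
  ultimately show ?thesis
    using geom_quotient_diff[OF e, of n] assms
    by (simp add: admissible_pair_def)
qed

section \<open>Zeros on the boundary family of triples\<close>

text \<open>
  The arguments of \<open>hsym\<close> are the sum and the product of the triple
  \<open>(e\<^bsup>it\<^esup>, e\<^bsup>-it\<^esup>, -1 / (2 cos t))\<close>.
\<close>

definition boundary_root :: "nat \<Rightarrow> real \<Rightarrow> bool" where
  "boundary_root n t \<longleftrightarrow> hsym (2 * cos t - 1 / (2 * cos t)) (- 1 / (2 * cos t)) n = 0"

lemma sin_three_term:
  "sin (real (Suc (Suc k)) * t) = 2 * cos t * sin (real (Suc k) * t) - sin (real k * t)"
proof -
  have "sin (real (Suc (Suc k)) * t) = sin (real (Suc k) * t + t)"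
       "sin (real k * t) = sin (real (Suc k) * t - t)"
    by (simp_all add: algebra_simps)
  thus ?thesis unfolding sin_add sin_diff by simp
qed

text \<open>
  With \<open>(a, b, c) = (e\<^bsup>it\<^esup>, e\<^bsup>-it\<^esup>, -1/y)\<close> this is the bialternant formula, which writes \<open>hsym\<close> as
  a quotient of \<open>a\<^bsup>n+2\<^esup>(b - c) + b\<^bsup>n+2\<^esup>(c - a) + c\<^bsup>n+2\<^esup>(a - b)\<close> by a Vandermonde determinant,
  after division by \<open>2i\<close> and multiplication by \<open>y\<close>. Each of the three summands on the left satisfies
  the recurrence of \<open>hsym\<close>, so it suffices to compare three initial values.
\<close>

lemma hsym_trigonometric:
  assumes c: "cos t \<noteq> 0"
  defines "y \<equiv> 2 * cos t"
  shows "sin (real (n + 2) * t) + y * sin (real (n + 1) * t) + y * (- 1 / y) ^ (n + 2) * sin t =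
           sin t * (2 * y + 1 / y) * hsym (y - 1 / y) (- 1 / y) n"
proof -
  have y: "y \<noteq> 0" using c by (simp add: y_def)
  define S where "S k = sin (real k * t)" for k
  have S: "S (Suc (Suc k)) = y * S (Suc k) - S k" for k
    unfolding S_def y_def by (rule sin_three_term)
  have S0: "S 0 = 0" and S1: "S (Suc 0) = sin t" by (simp_all add: S_def)
  define q where "q = 1 / y"
  have yq: "y * q = 1" using y by (simp add: q_def)
  have S3: "S (k + 3) = (y - q) * S (k + 2) - q * S k" for k
    using yq by (simp add: S eval_nat_numeral) algebra
  have q3: "(- q) ^ (k + 3) = (y - q) * (- q) ^ (k + 2) - q * (- q) ^ k" for k
  proof -
    have "X * (- q) ^ 3 = (y - q) * (X * (- q)\<^sup>2) - q * X" for X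
      using yq by algebra
    thus ?thesis unfolding power_add .
  qed
  define E where "E k = S (k + 2) + y * S (k + 1) + y * (- q) ^ (k + 2) * sin t" for k
  have E3: "E (Suc (Suc (Suc k))) = (y - q) * E (Suc (Suc k)) - q * E k" for k
  proof -
    let ?k2 = "Suc (Suc k)" and ?k3 = "Suc (Suc (Suc k))"
    have "S (?k3 + 2) = (y - q) * S (?k2 + 2) - q * S (k + 2)"
         "S (?k3 + 1) = (y - q) * S (?k2 + 1) - q * S (k + 1)"
         "(- q) ^ (?k3 + 2) = (y - q) * (- q) ^ (?k2 + 2) - q * (- q) ^ (k + 2)"
      using S3[of "k + 2"] S3[of "k + 1"] q3[of "k + 2"]
      by (simp_all add: eval_nat_numeral del: power_Suc)
    thus ?thesis unfolding E_def by (simp only:) (simp add: algebra_simps)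
  qed
  have "E n = sin t * (2 * y + q) * hsym (y - q) (- q) n"
  proof (induction "y - q" "- q" n rule: hsym.induct)
    case 1
    show ?case using yq by (simp add: E_def S S0 S1 power2_eq_square) algebra
  next
    case 2
    show ?case using yq by (simp add: E_def S S0 S1 eval_nat_numeral) algebra
  next
    case 3
    show ?case using yq by (simp add: E_def S S0 S1 eval_nat_numeral) algebra
  next
    case (4 n)
    show ?case using 4 unfolding E3 hsym.simps by algebra
  qed
  thus ?thesis by (simp add: E_def S_def q_def)
qed

definition boundary_function :: "nat \<Rightarrow> real \<Rightarrow> real" where
  "boundary_function n t = sin (real (n + 2) * t) + 2 * cos t * sin (real (n + 1) * t)
     + 2 * cos t * (- 1 / (2 * cos t)) ^ (n + 2) * sin t"

text \<open>
  At these points \<open>(n + 2) t\<close> and \<open>(n + 1) t\<close> are \<open>k \<pi> + \<pi>/2 \<plusminus> t/2\<close>, so that both leading sines of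
  \<open>boundary_function\<close> equal \<open>(-1)\<^bsup>k\<^esup> cos (t/2)\<close>.
\<close>

definition sample_point :: "nat \<Rightarrow> nat \<Rightarrow> real" where
  "sample_point n k = (2 * real k + 1) * pi / (2 * real n + 3)"

lemma sample_point_bounds:
  assumes "3 * k \<le> n"
  shows "0 < sample_point n k" "sample_point n k \<le> pi / 3"
proof -
  have "(2 * real k + 1) * 3 \<le> 2 * real n + 3" using of_nat_mono[OF assms, where ?'a = real] by simp
  hence "(2 * real k + 1) / (2 * real n + 3) * pi \<le> 1 / 3 * pi"
    by (intro mult_right_mono) (simp_all add: field_simps)
  thus "sample_point n k \<le> pi / 3" by (simp add: sample_point_def)
  show "0 < sample_point n k" by (simp add: sample_point_def add_pos_nonneg)
qed

lemma sample_point_mono: "j \<le> k \<Longrightarrow> sample_point n j \<le> sample_point n k"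
  by (simp add: sample_point_def divide_right_mono)

lemma cos_ge_half_iff:
  assumes "\<bar>t\<bar> \<le> pi"
  shows "1 / 2 \<le> cos t \<longleftrightarrow> \<bar>t\<bar> \<le> pi / 3" "1 / 2 < cos t \<longleftrightarrow> \<bar>t\<bar> < pi / 3"
proof -
  have "cos t = cos \<bar>t\<bar>" by simp
  thus "1 / 2 \<le> cos t \<longleftrightarrow> \<bar>t\<bar> \<le> pi / 3" "1 / 2 < cos t \<longleftrightarrow> \<bar>t\<bar> < pi / 3"
    using cos_mono_le_eq[of "pi / 3" "\<bar>t\<bar>"] cos_mono_less_eq[of "pi / 3" "\<bar>t\<bar>"] assms
    by (simp_all add: cos_60)
qed

lemma cos_ne_zero_third: "\<bar>t\<bar> \<le> pi / 3 \<Longrightarrow> cos t \<noteq> 0"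
  using cos_ge_half_iff(1)[of t] pi_gt_zero by fastforce

text \<open>
  For \<open>t \<le> \<pi>/3\<close> one has \<open>2 cos t \<ge> 1\<close> and \<open>cos (t/2) > 1/2\<close>; so the leading terms add up to more
  than 1 in absolute value, while the remaining term is at most 1.
\<close>

lemma boundary_function_alternates:
  assumes "3 * k \<le> n"
  shows "0 < (- 1) ^ k * boundary_function n (sample_point n k)"
proof -
  define t where "t = sample_point n k"
  have t: "0 < t" "t \<le> pi / 3" using sample_point_bounds[OF assms] by (simp_all add: t_def)
  have c: "1 / 2 \<le> cos t" and ch: "1 / 2 < cos (t / 2)"
    using t cos_ge_half_iff[of t] cos_ge_half_iff[of "t / 2"] by simp_all
  define y where "y = 2 * cos t"
  have y: "1 \<le> y" using c by (simp add: y_def)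
  have "(2 * real n + 3) * t = (2 * real k + 1) * pi"
    by (simp add: t_def sample_point_def)
  hence a: "real (n + 2) * t = (pi / 2 + t / 2) + real k * pi"
           "real (n + 1) * t = (pi / 2 - t / 2) + real k * pi"
    by (simp_all add: field_simps)
  have s: "sin (real (n + 2) * t) = (- 1) ^ k * cos (t / 2)"
          "sin (real (n + 1) * t) = (- 1) ^ k * cos (t / 2)"
    unfolding a by (subst sin_add, simp add: sin_add sin_diff)+
  have pm: "(- 1 :: real) ^ k * (- 1) ^ k = 1" by (simp flip: power_mult_distrib)
  have small: "\<bar>y * (- 1 / y) ^ (n + 2) * sin t\<bar> \<le> 1"
  proof -
    have "\<bar>y * (- 1 / y) ^ (n + 2) * sin t\<bar> = (1 / y) ^ (n + 1) * \<bar>sin t\<bar>"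
      using y by (simp add: abs_mult power_abs)
    also have "\<dots> \<le> 1 * 1"
      using y by (intro mult_mono power_le_one) simp_all
    finally show ?thesis by simp
  qed
  have "(- 1) ^ k * boundary_function n t =
          (1 + y) * cos (t / 2) + (- 1) ^ k * (y * (- 1 / y) ^ (n + 2) * sin t)"
  proof -
    have "e * (e * C + y * (e * C) + W) = (1 + y) * C + e * W" if "e * e = 1" for e C W :: real
      using that by algebra
    from this[OF pm] show ?thesis unfolding boundary_function_def s y_def[symmetric] .
  qed
  moreover have "1 < (1 + y) * cos (t / 2)"
  proof -
    have "2 * cos (t / 2) \<le> (1 + y) * cos (t / 2)" using y ch by (intro mult_right_mono) auto
    thus ?thesis using ch by linarith
  qed
  moreover have "\<bar>(- 1) ^ k * (y * (- 1 / y) ^ (n + 2) * sin t)\<bar> \<le> 1"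
    using small by (simp add: abs_mult power_abs)
  ultimately show ?thesis unfolding t_def by linarith
qed

lemma boundary_root_between_samples:
  assumes "k < n div 3"
  obtains t where "sample_point n k < t" "t < sample_point n (Suc k)" "boundary_root n t"
proof -
  define a b where "a = sample_point n k" and "b = sample_point n (Suc k)"
  have k: "3 * k \<le> n" "3 * Suc k \<le> n" using assms by auto
  have ab: "0 < a" "a \<le> b" "b \<le> pi / 3"
    using sample_point_bounds[OF k(1)] sample_point_bounds[OF k(2)] sample_point_mono[of k "Suc k" n]
    by (simp_all add: a_def b_def)
  have cos: "1 / 2 \<le> cos t" if "a \<le> t" "t \<le> b" for t
    using that ab cos_ge_half_iff[of t] by simp
  define g where "g t = (- 1) ^ k * boundary_function n t" for t
  have ga: "0 < g a" and gb: "g b < 0"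
    using boundary_function_alternates[OF k(1)] boundary_function_alternates[OF k(2)]
    by (simp_all add: g_def a_def b_def)
  have "continuous_on {a..b} g"
    unfolding g_def boundary_function_def
    by (intro continuous_intros) (use cos in force)+
  then obtain t where t: "a \<le> t" "t \<le> b" "g t = 0"
    using IVT2'[of g b 0 a] ga gb ab by auto
  have "t \<noteq> a" "t \<noteq> b" using t ga gb by auto
  hence t': "a < t" "t < b" using t by auto
  have c: "1 / 2 \<le> cos t" using cos t by simp
  have "sin t > 0" using t' ab pi_gt_zero by (intro sin_gt_zero) linarith+
  moreover have "2 * (2 * cos t) + 1 / (2 * cos t) > 0" using c by (intro add_pos_pos) simp_all
  moreover have "boundary_function n t = 0" using t by (simp add: g_def)
  ultimately have "boundary_root n t"
    using hsym_trigonometric[of t n] c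
    unfolding boundary_function_def boundary_root_def by auto
  thus ?thesis using that t' unfolding a_def b_def by blast
qed

lemma boundary_root_minus [simp]: "boundary_root n (- t) = boundary_root n t"
  by (simp add: boundary_root_def)

section \<open>All roots of \<open>hsym\<close> come from the boundary family\<close>

text \<open>The scale-invariant quantity \<open>p / s\<^sup>3\<close> of the triple with parameter \<open>t\<close>.\<close>

definition boundary_invariant :: "real \<Rightarrow> real" where
  "boundary_invariant t = (- 1 / (2 * cos t)) / (2 * cos t - 1 / (2 * cos t)) ^ 3"

text \<open>
  In terms of \<open>r = (2 cos t)\<^sup>2 > 1\<close> the invariant is \<open>- r / (r - 1)\<^sup>3\<close>, which increases with \<open>r\<close>, and
  \<open>r\<close> decreases as the parameter grows.
\<close>

lemma boundary_invariant_strict_antimono: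
  assumes "0 < t" "t < u" "u < pi / 3"
  shows "boundary_invariant u < boundary_invariant t"
proof -
  define x y where "x = (2 * cos t)\<^sup>2" and "y = (2 * cos u)\<^sup>2"
  have c: "1 / 2 < cos u" "cos u < cos t"
    using assms cos_ge_half_iff[of u] cos_mono_less_eq[of u t] by simp_all
  have y1: "1 < y" unfolding y_def using c by (intro one_less_power) auto
  have xy: "y < x" unfolding x_def y_def using c by (intro power_strict_mono) auto
  have inv: "boundary_invariant v = - ((2 * cos v)\<^sup>2 / ((2 * cos v)\<^sup>2 - 1) ^ 3)"
    if "1 / 2 < cos v" for v
  proof -
    define r where "r = 2 * cos v"
    have r: "1 < r" using that by (simp add: r_def)
    have "1 < r\<^sup>2" using r by (intro one_less_power) auto
    moreover have "r - 1 / r = (r\<^sup>2 - 1) / r" using r by (simp add: field_simps power2_eq_square)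
    ultimately have "(- 1 / r) / (r - 1 / r) ^ 3 = - (r\<^sup>2 / (r\<^sup>2 - 1) ^ 3)"
      using r by (simp add: power_divide power3_eq_cube power2_eq_square)
    thus ?thesis by (simp add: boundary_invariant_def r_def)
  qed
  have "(x * (y - 1)) * (y - 1)\<^sup>2 < (y * (x - 1)) * (x - 1)\<^sup>2"
  proof (rule mult_strict_mono)
    show "x * (y - 1) < y * (x - 1)" using xy by (simp add: algebra_simps)
    show "(y - 1)\<^sup>2 < (x - 1)\<^sup>2" using xy y1 by (intro power_strict_mono) auto
  qed (use xy y1 in auto)
  hence "x * (y - 1) ^ 3 < y * (x - 1) ^ 3" by (simp add: power3_eq_cube power2_eq_square mult.assoc)
  hence "x / (x - 1) ^ 3 < y / (y - 1) ^ 3"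
    using xy y1 by (simp add: divide_simps)
  thus ?thesis using c inv[of t] inv[of u] by (simp add: x_def y_def)
qed

lemma boundary_root_imp_hsym_invariant:
  assumes "boundary_root n t" "1 / 2 < cos t"
  shows "hsym 1 (boundary_invariant t) n = 0"
proof -
  define r where "r = 2 * cos t"
  have r: "1 < r" using assms by (simp add: r_def)
  have "1 < r\<^sup>2" using r by (intro one_less_power) auto
  hence s: "r - 1 / r \<noteq> 0" using r by (auto simp: field_simps power2_eq_square)
  hence "(r - 1 / r) ^ n * hsym 1 (boundary_invariant t) n = hsym (r - 1 / r) (- 1 / r) n"
    unfolding hsym_homogeneous[symmetric] boundary_invariant_def r_def[symmetric] by simp
  thus ?thesis using s assms by (simp add: boundary_root_def r_def)
qed

text \<open>
  The zeros found by sign changes already exhaust the degree of the polynomial.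
\<close>

lemma hsym_roots:
  fixes x :: complex
  assumes "hsym 1 x n = 0"
  obtains t where "0 < t" "t < pi / 3" "x = of_real (boundary_invariant t)"
proof -
  have "\<forall>k. \<exists>t. k < n div 3 \<longrightarrow>
          sample_point n k < t \<and> t < sample_point n (Suc k) \<and> boundary_root n t"
    using boundary_root_between_samples by metis
  then obtain \<theta> where \<theta>: "\<And>k. k < n div 3 \<Longrightarrow> sample_point n k < \<theta> k"
      "\<And>k. k < n div 3 \<Longrightarrow> \<theta> k < sample_point n (Suc k)"
      "\<And>k. k < n div 3 \<Longrightarrow> boundary_root n (\<theta> k)"
    by metis
  have range: "0 < \<theta> k" "\<theta> k < pi / 3" if "k < n div 3" for k
  proof -
    have "3 * k \<le> n" "3 * Suc k \<le> n" using that by auto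
    thus "0 < \<theta> k" "\<theta> k < pi / 3"
      using \<theta>(1,2)[OF that] sample_point_bounds[of k n] sample_point_bounds[of "Suc k" n]
      by simp_all
  qed
  define A where "A = (\<lambda>k. complex_of_real (boundary_invariant (\<theta> k))) ` {..<n div 3}"
  let ?R = "{z. poly (hsym 1 [:0, 1:] n) z = (0 :: complex)}"
  have "poly (hsym 1 [:0, 1:] n) (0 :: complex) \<noteq> 0" by (simp add: poly_hsym hsym_zero_right)
  hence nz: "hsym 1 [:0, 1:] n \<noteq> (0 :: complex poly)" by auto
  have "inj_on (\<lambda>k. complex_of_real (boundary_invariant (\<theta> k))) {..<n div 3}"
  proof (rule linorder_inj_onI')
    fix j k assume jk: "j \<in> {..<n div 3}" "k \<in> {..<n div 3}" "j < k"
    have "\<theta> j < \<theta> k"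
      using \<theta>(2)[of j] \<theta>(1)[of k] sample_point_mono[of "Suc j" k n] jk by simp
    thus "complex_of_real (boundary_invariant (\<theta> j)) \<noteq> of_real (boundary_invariant (\<theta> k))"
      using boundary_invariant_strict_antimono[of "\<theta> j" "\<theta> k"] range jk by auto
  qed
  hence cardA: "card A = n div 3" by (simp add: A_def card_image)
  have "card ?R \<le> degree (hsym 1 [:0, 1:] n :: complex poly)"
    by (rule card_poly_roots_bound[OF nz])
  also have "\<dots> \<le> n div 3" by (rule degree_hsym)
  finally have "card ?R \<le> card A" by (simp add: cardA)
  moreover have "A \<subseteq> ?R"
  proof
    fix z assume "z \<in> A"
    then obtain k where k: "k < n div 3" "z = of_real (boundary_invariant (\<theta> k))"
      by (auto simp: A_def)
    have "1 / 2 < cos (\<theta> k)" using range[OF k(1)] cos_ge_half_iff[of "\<theta> k"] by simp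
    hence "hsym 1 (boundary_invariant (\<theta> k)) n = 0"
      using boundary_root_imp_hsym_invariant \<theta>(3) k by blast
    thus "z \<in> ?R"
      using hsym_of_real[of 1 "boundary_invariant (\<theta> k)" n, where ?'a = complex]
      by (simp add: poly_hsym k)
  qed
  ultimately have "A = ?R" using poly_roots_finite[OF nz] by (intro card_seteq)
  moreover have "x \<in> ?R" using assms by (simp add: poly_hsym)
  ultimately show ?thesis using that range by (auto simp: A_def)
qed

section \<open>The curves as ratios within the boundary family\<close>

lemma curve_parametrisation:
  assumes "1 / 2 \<le> cos t"
  shows "cis (2 * t) \<in> C3"
    and "- cis t / of_real (2 * cos t) \<in> C2"
    and "- of_real (2 * cos t) * cis t \<in> C1"
proof -
  have c2: "1 / 4 \<le> (cos t)\<^sup>2"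
    using power_mono[OF assms, of 2] by (simp add: power2_eq_square)
  have sc: "(sin t)\<^sup>2 = 1 - (cos t)\<^sup>2" using sin_squared_eq by blast
  have "- 1 / 2 \<le> cos (2 * t)" unfolding cos_double_cos using c2 by simp
  thus "cis (2 * t) \<in> C3" by (simp add: C3_def)
  have "\<bar>sin t\<bar> \<le> \<bar>sqrt 3 * cos t\<bar>"
    unfolding abs_le_square_iff using c2 sc by (simp add: power_mult_distrib)
  hence "\<bar>sin t\<bar> \<le> sqrt 3 * cos t" using assms by (simp add: abs_mult)
  thus "- cis t / of_real (2 * cos t) \<in> C2"
    using assms
    by (simp add: C2_def Re_divide_of_real Im_divide_of_real field_simps abs_le_iff
        del: of_real_mult)
  have "(1 - 2 * (cos t)\<^sup>2)\<^sup>2 + (2 * cos t * sin t)\<^sup>2 = 1"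
    using sc by (simp add: power_mult_distrib) (simp add: power2_eq_square algebra_simps)
  thus "- of_real (2 * cos t) * cis t \<in> C1"
    using c2 by (simp add: C1_def power2_eq_square mult.assoc)
qed

lemma C3_obtain:
  assumes "z \<in> C3"
  obtains t where "\<bar>t\<bar> \<le> pi / 3" "z = cis (2 * t)"
proof -
  define t where "t = Arg z / 2"
  have n: "norm z = 1" using assms by (simp add: C3_def cmod_def)
  hence "z \<noteq> 0" by auto
  hence z: "z = cis (2 * t)" using n cis_Arg[of z] by (auto simp: t_def sgn_div_norm)
  have t: "\<bar>t\<bar> \<le> pi / 2" using Arg_bounded[of z] by (auto simp: t_def abs_le_iff)
  hence "0 \<le> cos t" by (intro cos_ge_zero) auto
  moreover have "- 1 / 2 \<le> cos (2 * t)" using assms z by (simp add: C3_def)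
  hence "(1 / 2)\<^sup>2 \<le> (cos t)\<^sup>2" unfolding cos_double_cos by (simp add: power2_eq_square)
  ultimately have "1 / 2 \<le> cos t" by (rule power2_le_imp_le[rotated])
  hence "\<bar>t\<bar> \<le> pi / 3" using t cos_ge_half_iff(1)[of t] by linarith
  thus ?thesis using that z by blast
qed

lemma C2_obtain:
  assumes "z \<in> C2"
  obtains t where "\<bar>t\<bar> \<le> pi / 3" "z = - cis t / of_real (2 * cos t)"
proof -
  define x where "x = - 2 * Im z"
  define t where "t = arctan x"
  have t: "\<bar>t\<bar> < pi / 2" using arctan_bounded[of x] by (auto simp: t_def)
  have "\<bar>x\<bar> \<le> sqrt 3" using assms by (auto simp: C2_def x_def)
  hence "x\<^sup>2 \<le> (sqrt 3)\<^sup>2" by (rule abs_le_square_iff[THEN iffD1, OF order_trans]) simp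
  hence "sqrt (1 + x\<^sup>2) \<le> 2" by (intro real_le_lsqrt) auto
  hence c: "1 / 2 \<le> cos t"
    by (simp add: t_def cos_arctan field_simps add_pos_nonneg)
  have "sin t / cos t = x" using tan_arctan[of x] by (simp add: t_def tan_def)
  hence "z = - cis t / of_real (2 * cos t)"
    using assms c
    by (simp add: complex_eq_iff C2_def x_def Re_divide_of_real Im_divide_of_real field_simps
        del: of_real_mult)
  moreover have "\<bar>t\<bar> \<le> pi / 3" using c t cos_ge_half_iff(1)[of t] by linarith
  ultimately show ?thesis using that by blast
qed

text \<open>
  The map \<open>z \<mapsto> - (z + 1)\<close> carries \<open>C1\<close> to \<open>C3\<close>, and \<open>1 + e\<^bsup>2it\<^esup> = 2 cos t e\<^bsup>it\<^esup>\<close>.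
\<close>

lemma C1_obtain:
  assumes "z \<in> C1"
  obtains t where "\<bar>t\<bar> \<le> pi / 3" "z = - of_real (2 * cos t) * cis t"
proof -
  have "- (z + 1) \<in> C3" using assms by (auto simp: C1_def C3_def power2_eq_square algebra_simps)
  then obtain t where t: "\<bar>t\<bar> \<le> pi / 3" "- (z + 1) = cis (2 * t)" by (rule C3_obtain)
  have "z = - 1 - cis (2 * t)" unfolding t(2)[symmetric] by simp
  also have "\<dots> = - of_real (2 * cos t) * cis t"
    by (simp add: complex_eq_iff cos_double_cos sin_double power2_eq_square)
  finally show ?thesis using that t by blast
qed

lemma boundary_ratio_in_curves:
  assumes c: "1 / 2 \<le> cos t"
    and "x \<in> {cis t, cis (- t), of_real (- 1 / (2 * cos t))}"
    and "x' \<in> {cis t, cis (- t), of_real (- 1 / (2 * cos t))}"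
  shows "x / x' \<in> C1 \<union> C2 \<union> C3"
proof -
  have c': "1 / 2 \<le> cos (- t)" using c by simp
  have one: "1 \<in> C3" by (simp add: C3_def)
  have nz: "cos t \<noteq> 0" using c by auto
  have 1: "cis t / cis (- t) = cis (2 * t)" "cis (- t) / cis t = cis (2 * - t)"
    by (simp_all add: cis_divide)
  have 2: "cis u / of_real (- 1 / (2 * cos t)) = - of_real (2 * cos u) * cis u"
          "of_real (- 1 / (2 * cos t)) / cis (- u) = - cis u / of_real (2 * cos u)"
    if "u = t \<or> u = - t" for u
    using that nz by (auto simp: field_simps simp flip: cis_inverse)
  show ?thesis
    using assms(2,3) one nz 1 2[of t] 2[of "- t"]
      curve_parametrisation[OF c] curve_parametrisation[OF c']
    by (auto simp: ac_simps)
qed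

text \<open>
  The entries of the triple are the roots of the cubic \<open>T\<^sup>3 - s T\<^sup>2 - p\<close>.
\<close>

lemma cubic_root_at_boundary:
  fixes x :: complex
  assumes c: "cos t \<noteq> 0"
    and x: "x ^ 3 = of_real (2 * cos t - 1 / (2 * cos t)) * x\<^sup>2 + of_real (- 1 / (2 * cos t))"
  shows "x \<in> {cis t, cis (- t), of_real (- 1 / (2 * cos t))}"
proof -
  define y q where "y = complex_of_real (2 * cos t)" and "q = complex_of_real (1 / (2 * cos t))"
  have yq: "y * q = 1" using c by (simp add: y_def q_def)
  have s: "cis t + cis (- t) = y" by (simp add: complex_eq_iff y_def)
  have p: "cis t * cis (- t) = 1" by (simp add: cis_mult)
  have "x ^ 3 = (y - q) * x\<^sup>2 - q" using x by (simp add: y_def q_def)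
  hence "(x - cis t) * (x - cis (- t)) * (x + q) = 0" using yq s p by algebra
  thus ?thesis by (auto simp: q_def add_eq_0_iff2)
qed

section \<open>Location and density of admissible values\<close>

text \<open>
  After scaling by a common factor \<open>k\<close>, the numbers \<open>z\<close> and \<open>1\<close> satisfy the cubic of a boundary
  triple, so \<open>z\<close> is a ratio of two of its entries. Two cases escape this argument: \<open>z = w\<close>, where
  \<open>z = -2\<close>, and \<open>s = 0\<close>, where \<open>p / s\<^sup>3\<close> is meaningless and \<open>z\<close> is a primitive cube root of unity.
\<close>

lemma admissible_pair_in_curves:
  assumes adm: "admissible_pair m z w" and m: "1 \<le> m"
  shows "z \<in> C1 \<union> C2 \<union> C3"
proof -
  obtain n where n: "m = Suc n" using m by (cases m) auto
  have nz: "z \<noteq> 0" "w \<noteq> 0" using adm by (auto simp: admissible_pair_def)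
  have e: "z * w + z + w = 0"
    using adm nz reciprocal_sum_iff by (auto simp: admissible_pair_def)
  define s p where "s = z + w + 1" and "p = z * w"
  have prod: "(z - w) * hsym s p n = 0"
    using geom_quotient_diff[OF e, of n] adm by (simp add: admissible_pair_def n s_def p_def)
  have z3: "z ^ 3 = s * z\<^sup>2 + p" and one3: "1 = s + p"
    unfolding s_def p_def using e by algebra+
  show ?thesis
  proof (cases "z = w")
    case True
    hence "z * z + z + z = 0" using e by simp
    hence "z * (z + 2) = 0" by algebra
    hence "z = - 2" using nz by (simp add: add_eq_0_iff2)
    thus ?thesis by (simp add: C1_def)
  next
    case zw: False
    show ?thesis
    proof (cases "s = 0")
      case True
      hence q: "z\<^sup>2 + z + 1 = 0" unfolding s_def using e by algebra
      define a b where "a = Re z" and "b = Im z"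
      have re: "a\<^sup>2 - b\<^sup>2 + a + 1 = 0" and im: "b * (2 * a + 1) = 0"
        using arg_cong[OF q, of Re] arg_cong[OF q, of Im]
        by (simp_all add: a_def b_def power2_eq_square algebra_simps)
      have "b \<noteq> 0"
      proof
        assume "b = 0"
        hence "(a + 1 / 2)\<^sup>2 + 3 / 4 = 0" using re by (simp add: power2_eq_square algebra_simps)
        thus False using zero_le_power2[of "a + 1 / 2"] by linarith
      qed
      hence a: "a = - 1 / 2" using im by simp
      hence "a\<^sup>2 + b\<^sup>2 = 1" using re by (simp add: power2_eq_square)
      thus ?thesis using a by (simp add: C3_def a_def b_def)
    next
      case s: False
      have "s ^ n * hsym 1 (p / s ^ 3) n = hsym s p n"
        unfolding hsym_homogeneous[symmetric] using s by simp
      hence "hsym 1 (p / s ^ 3) n = 0" using prod zw s by auto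
      then obtain t where t: "0 < t" "t < pi / 3" "p / s ^ 3 = of_real (boundary_invariant t)"
        by (rule hsym_roots)
      have c: "1 / 2 < cos t" using t cos_ge_half_iff[of t] by simp
      define \<sigma> where "\<sigma> = 2 * cos t - 1 / (2 * cos t)"
      have "1 < (2 * cos t)\<^sup>2" using c by (intro one_less_power) auto
      hence \<sigma>: "\<sigma> \<noteq> 0" using c by (auto simp: \<sigma>_def field_simps power2_eq_square)
      \<comment> \<open>the scaling that gives \<open>(z, w, 1)\<close> the same \<open>s\<close>, hence the same \<open>p\<close>, as the boundary triple\<close>
      define k where "k = of_real \<sigma> / s"
      have k: "k \<noteq> 0" using \<sigma> s by (simp add: k_def)
      have ks: "k * s = of_real \<sigma>" using s by (simp add: k_def)
      have "k ^ 3 * p = of_real (\<sigma> ^ 3) * (p / s ^ 3)"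
        by (simp add: k_def power_divide)
      also have "\<dots> = of_real (\<sigma> ^ 3 * boundary_invariant t)" by (simp add: t)
      also have "\<sigma> ^ 3 * boundary_invariant t = - 1 / (2 * cos t)"
        using \<sigma> by (simp add: boundary_invariant_def \<sigma>_def)
      finally have kp: "k ^ 3 * p = of_real (- 1 / (2 * cos t))" .
      have root: "k * x \<in> {cis t, cis (- t), of_real (- 1 / (2 * cos t))}"
        if "x ^ 3 = s * x\<^sup>2 + p" for x
      proof (rule cubic_root_at_boundary)
        have "(k * x) ^ 3 = (k * s) * (k * x)\<^sup>2 + k ^ 3 * p" using that by algebra
        thus "(k * x) ^ 3 = of_real (2 * cos t - 1 / (2 * cos t)) * (k * x)\<^sup>2
                + of_real (- 1 / (2 * cos t))"
          unfolding ks kp \<sigma>_def .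
      qed (use c in auto)
      have "(k * z) / (k * 1) \<in> C1 \<union> C2 \<union> C3"
        using root[OF z3] root[of 1] one3 c by (intro boundary_ratio_in_curves[of t]) auto
      thus ?thesis using k by simp
    qed
  qed
qed

lemma admissible_pair_sym: "admissible_pair m z w \<Longrightarrow> admissible_pair m w z"
  by (auto simp: admissible_pair_def add.commute)

lemma admissible_pairs_from_boundary_root:
  assumes r: "boundary_root n t" and c: "cos t \<noteq> 0"
  shows "\<exists>w. admissible_pair (Suc n) (cis (2 * t)) w"
    and "\<exists>w. admissible_pair (Suc n) (- cis t / of_real (2 * cos t)) w"
    and "\<exists>w. admissible_pair (Suc n) (- of_real (2 * cos t) * cis t) w"
proof -
  define q where "q = complex_of_real (- 1 / (2 * cos t))"
  define a b where "a = cis t" and "b = cis (- t)"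
  have nz: "q \<noteq> 0" "a \<noteq> 0" "b \<noteq> 0" using c by (simp_all add: q_def a_def b_def)
  have ab: "a * b = 1" "a + b = of_real (2 * cos t)"
    by (simp_all add: a_def b_def cis_mult complex_eq_iff)
  have "(a + b) * q = - 1" unfolding ab q_def using c by simp
  hence e2: "a * b + b * q + q * a = 0" using ab by algebra
  have h: "hsym (a + b + q) (a * b * q) n = 0"
    using r hsym_of_real[of "2 * cos t - 1 / (2 * cos t)" "- 1 / (2 * cos t)" n, where ?'a = complex]
    by (simp add: ab boundary_root_def q_def)
  have "admissible_pair (Suc n) (a / b) (q / b)"
    by (rule admissible_pair_ratios) (use nz e2 h in \<open>simp_all add: ac_simps\<close>)
  moreover have "a / b = cis (2 * t)" by (simp add: a_def b_def cis_divide)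
  ultimately show "\<exists>w. admissible_pair (Suc n) (cis (2 * t)) w" by auto
  have "admissible_pair (Suc n) (q / b) (a / b)"
    by (rule admissible_pair_ratios) (use nz e2 h in \<open>simp_all add: ac_simps\<close>)
  moreover have "q / b = - cis t / of_real (2 * cos t)"
    using c by (simp add: q_def b_def field_simps flip: cis_inverse)
  ultimately show "\<exists>w. admissible_pair (Suc n) (- cis t / of_real (2 * cos t)) w" by auto
  have "admissible_pair (Suc n) (a / q) (b / q)"
    by (rule admissible_pair_ratios) (use nz e2 h in \<open>simp_all add: ac_simps\<close>)
  moreover have "a / q = - of_real (2 * cos t) * cis t"
    using c by (simp add: q_def a_def field_simps)
  ultimately show "\<exists>w. admissible_pair (Suc n) (- of_real (2 * cos t) * cis t) w" by auto
qed

text \<open>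
  With \<open>D\<close> the spacing and \<open>q = n div 3\<close>, the sample points \<open>(k + 1/2) D\<close> with \<open>k \<le> q\<close> enclose
  \<open>q\<close> zeros. For \<open>t0 < q D\<close> one of these intervals is close to \<open>t0\<close>. For larger \<open>t0\<close> the last zero
  serves, because the last sample point is at most \<open>2 D / 3\<close> away from \<open>\<pi>/3\<close>.
\<close>

lemma boundary_root_near:
  assumes n: "3 \<le> n" and t0: "0 \<le> t0" "t0 \<le> pi / 3"
  obtains t where "0 < t" "t < pi / 3" "boundary_root n t" "\<bar>t - t0\<bar> < 4 * pi / (2 * real n + 3)"
proof -
  define D where "D = 2 * pi / (2 * real n + 3)"
  have D: "D > 0" by (simp add: D_def add_nonneg_pos)
  have sp: "sample_point n k = (real k + 1 / 2) * D" for k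
    by (simp add: sample_point_def D_def field_simps)
  define q where "q = n div 3"
  have q: "1 \<le> q" using n by (simp add: q_def)
  define k0 where "k0 = nat \<lfloor>t0 / D\<rfloor>"
  have "real k0 \<le> t0 / D" "t0 / D < real k0 + 1"
    unfolding k0_def using t0 D by (simp_all add: floor_le_iff)
  hence k0: "real k0 * D \<le> t0" "t0 < (real k0 + 1) * D" using D by (simp_all add: field_simps)
  define k where "k = min k0 (q - 1)"
  have kq: "k < q" using q by (auto simp: k_def)
  obtain t where t: "sample_point n k < t" "t < sample_point n (Suc k)" "boundary_root n t"
    using boundary_root_between_samples kq unfolding q_def by blast
  have "3 * k \<le> n" "3 * Suc k \<le> n" using kq by (auto simp: q_def)
  hence "0 < t" "t < pi / 3" using t sample_point_bounds[of k n] sample_point_bounds[of "Suc k" n] by auto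
  moreover have "\<bar>t - t0\<bar> < 2 * D"
  proof (cases "k0 \<le> q - 1")
    case True
    thus ?thesis using t k0 D unfolding sp k_def by (simp add: algebra_simps abs_less_iff)
  next
    case False
    \<comment> \<open>the last zero is used; \<open>\<pi>/3 = (2 n + 3) / 6 * D\<close> bounds its distance from \<open>t0\<close>\<close>
    have "n \<le> 3 * q + 2" by (simp add: q_def)
    hence "real n \<le> 3 * real q + 2" by linarith
    hence "(2 * real n + 3) / 6 * D \<le> (real q + 7 / 6) * D"
      using D by (intro mult_right_mono) simp_all
    moreover have "(2 * real n + 3) / 6 * D = pi / 3" by (simp add: D_def field_simps)
    ultimately have u: "t0 \<le> (real q + 7 / 6) * D" using t0 by linarith
    have "real q * D \<le> real k0 * D" using False D by (intro mult_right_mono) auto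
    hence l: "real q * D \<le> t0" using k0 by linarith
    have "real q = real k + 1" using False q by (simp add: k_def)
    hence "D * real q = D * real k + D" by (simp add: algebra_simps)
    thus ?thesis using t u l D unfolding sp by (simp add: algebra_simps abs_less_iff)
  qed
  ultimately show ?thesis using that t by (simp add: D_def)
qed

lemma boundary_roots_dense:
  assumes t0: "\<bar>t0\<bar> \<le> pi / 3" and d: "0 < d"
  shows "\<forall>\<^sub>F n in sequentially. \<exists>t. \<bar>t\<bar> < pi / 3 \<and> boundary_root n t \<and> \<bar>t - t0\<bar> < d"
proof -
  obtain N where N: "4 * pi / d < real N" using reals_Archimedean2 by blast
  have "\<exists>t. \<bar>t\<bar> < pi / 3 \<and> boundary_root n t \<and> \<bar>t - t0\<bar> < d" if n: "n \<ge> max 3 N" for n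
  proof -
    have "4 * pi / d < 2 * real n + 3" using N n by linarith
    hence small: "4 * pi / (2 * real n + 3) < d" using d by (simp add: field_simps add_nonneg_pos)
    obtain t where t: "0 < t" "t < pi / 3" "boundary_root n t"
        "\<bar>t - \<bar>t0\<bar>\<bar> < 4 * pi / (2 * real n + 3)"
      using boundary_root_near[of n "\<bar>t0\<bar>"] n t0 by auto
    show ?thesis
    proof (cases "t0 \<ge> 0")
      case True
      thus ?thesis using t small by (intro exI[of _ t]) auto
    next
      case False
      thus ?thesis using t small by (intro exI[of _ "- t"]) auto
    qed
  qed
  thus ?thesis unfolding eventually_sequentially by blast
qed

text \<open>
  The parametrisation \<open>f\<close> stands for any of the three kinds of ratios that describe the curves.
\<close>

lemma admissible_values_near_curve_point:
  fixes f :: "real \<Rightarrow> complex"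
  assumes t0: "\<bar>t0\<bar> \<le> pi / 3" and cont: "isCont f t0" and U: "open U" "f t0 \<in> U"
    and adm: "\<And>n t. boundary_root n t \<Longrightarrow> cos t \<noteq> 0 \<Longrightarrow> \<exists>w. admissible_pair (Suc n) (f t) w"
  shows "\<forall>\<^sub>F m in sequentially. \<exists>z w. admissible_pair m z w \<and> z \<in> U"
proof -
  have "\<forall>\<^sub>F t in nhds t0. f t \<in> U"
    using cont U by (simp add: isCont_def topological_tendstoD tendsto_at_iff_tendsto_nhds)
  then obtain d where d: "d > 0" "\<And>t. \<bar>t - t0\<bar> < d \<Longrightarrow> f t \<in> U"
    unfolding eventually_nhds_metric dist_real_def by blast
  have "\<forall>\<^sub>F n in sequentially. \<exists>z w. admissible_pair (Suc n) z w \<and> z \<in> U"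
    using boundary_roots_dense[OF t0 d(1)]
  proof eventually_elim
    case (elim n)
    then obtain t where t: "\<bar>t\<bar> < pi / 3" "boundary_root n t" "\<bar>t - t0\<bar> < d" by blast
    hence "cos t \<noteq> 0" by (intro cos_ne_zero_third) simp
    thus ?case using adm t d by blast
  qed
  thus ?thesis by (subst (asm) eventually_sequentially_Suc)
qed

theorem lemma2:
  shows "(\<forall>m \<zeta>\<^sub>1 \<zeta>\<^sub>2. m \<ge> 1 \<and> admissible_pair m \<zeta>\<^sub>1 \<zeta>\<^sub>2 \<longrightarrow>
            \<zeta>\<^sub>1 \<in> C1 \<union> C2 \<union> C3 \<and> \<zeta>\<^sub>2 \<in> C1 \<union> C2 \<union> C3)
       \<and> (\<forall>p \<in> C1 \<union> C2 \<union> C3. \<forall>U. open U \<and> p \<in> U \<longrightarrow>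
            (\<forall>\<^sub>F m in sequentially. \<exists>\<zeta>\<^sub>1 \<zeta>\<^sub>2. admissible_pair m \<zeta>\<^sub>1 \<zeta>\<^sub>2 \<and> \<zeta>\<^sub>1 \<in> U))"
proof (intro conjI allI impI ballI)
  fix m z w assume "1 \<le> m \<and> admissible_pair m z w"
  thus "z \<in> C1 \<union> C2 \<union> C3" "w \<in> C1 \<union> C2 \<union> C3"
    using admissible_pair_in_curves admissible_pair_sym by blast+
next
  fix p U assume p: "p \<in> C1 \<union> C2 \<union> C3" and U: "open U \<and> p \<in> U"
  have cis1: "isCont cis t" for t
    unfolding cis_conv_exp [abs_def] by (intro continuous_intros)
  have cis: "isCont (\<lambda>u. cis (c * u)) t" for c t
    unfolding cis_conv_exp by (intro continuous_intros)
  from p consider "p \<in> C1" | "p \<in> C2" | "p \<in> C3" by blast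
  thus "\<forall>\<^sub>F m in sequentially. \<exists>z w. admissible_pair m z w \<and> z \<in> U"
  proof cases
    case 1
    then obtain t where t: "\<bar>t\<bar> \<le> pi / 3" "p = - of_real (2 * cos t) * cis t" by (rule C1_obtain)
    show ?thesis
      by (rule admissible_values_near_curve_point[OF t(1), of "\<lambda>t. - of_real (2 * cos t) * cis t"])
         (use U t cos_ne_zero_third[OF t(1)] admissible_pairs_from_boundary_root
          in \<open>auto intro!: continuous_intros cis cis1\<close>)
  next
    case 2
    then obtain t where t: "\<bar>t\<bar> \<le> pi / 3" "p = - cis t / of_real (2 * cos t)" by (rule C2_obtain)
    show ?thesis
      by (rule admissible_values_near_curve_point[OF t(1), of "\<lambda>t. - cis t / of_real (2 * cos t)"])
         (use U t cos_ne_zero_third[OF t(1)] admissible_pairs_from_boundary_root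
          in \<open>auto intro!: continuous_intros cis cis1\<close>)
  next
    case 3
    then obtain t where t: "\<bar>t\<bar> \<le> pi / 3" "p = cis (2 * t)" by (rule C3_obtain)
    show ?thesis
      by (rule admissible_values_near_curve_point[OF t(1), of "\<lambda>t. cis (2 * t)"])
         (use U t cos_ne_zero_third[OF t(1)] admissible_pairs_from_boundary_root
          in \<open>auto intro!: continuous_intros cis cis1\<close>)
  qed
qed

end
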